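(* Let the integers $M(n)$, $n\ge 0$, be defined by $\sum_{n\geq 0}M(n)q^n=\dfrac{f_2^5f_5^5}{f_1f_{10}}$. Then for all integers $n\geq 0$ and $\alpha\geq 1$, \[ M(5^\alpha n+5^\alpha -1)\equiv 0 \pmod{5^{\alpha}}. \]
   Context: For a positive integer $k$, $f_k:=(q^k;q^k)_\infty=\prod_{i\geq 1}(1-q^{ki})$, regarded as a formal power series in $q$ with integer coefficients (invertible, since its constant term is $1$). *)

theory Defs
  imports "HOL-Analysis.Analysis" "HOL-Number_Theory.Cong"
begin

text \<open>
  The infinite product is a limit in the \<open>X\<close>-adic metric on formal power series.
  The index is shifted, so that the product over \<open>i \<ge> 0\<close> has the factors
  \<open>1 - X ^ k, 1 - X ^ (2 * k), \<dots>\<close>. Only \<open>k > 0\<close> is meaningful.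
\<close>

definition eulerf :: "nat \<Rightarrow> int fps" where
  "eulerf k = prodinf (\<lambda>i. 1 - fps_X ^ (k * Suc i))"

lemma eulerf_partial_prod_nth_stable:
  assumes "k > 0" and "n \<le> N"
  shows "fps_nth (\<Prod>i\<le>N. 1 - fps_X ^ (k * Suc i) :: int fps) n =
         fps_nth (\<Prod>i\<le>n. 1 - fps_X ^ (k * Suc i)) n"
  using assms(2)
proof (induction N rule: dec_induct)
  case (step N)
  have "n < k * Suc (Suc N)"
  proof -
    have "1 * Suc (Suc N) \<le> k * Suc (Suc N)"
      using assms(1) by (intro mult_le_mono1) simp
    thus ?thesis using step.hyps by simp
  qed
  thus ?case
    using step.IH by (simp add: algebra_simps fps_X_power_mult_nth del: mult_Suc_right)
qed simp

lemma eulerf_aux: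
  assumes "k > 0"
  defines "L \<equiv> Abs_fps (\<lambda>n. fps_nth (\<Prod>i\<le>n. 1 - fps_X ^ (k * Suc i) :: int fps) n)"
  shows "(\<lambda>i. 1 - fps_X ^ (k * Suc i)) has_prod L" and "fps_nth L 0 = 1"
proof -
  show 0: "fps_nth L 0 = 1"
    using assms(1) by (simp add: L_def)
  have "(\<lambda>N. \<Prod>i\<le>N. 1 - fps_X ^ (k * Suc i)) \<longlonglongrightarrow> L"
  proof (rule tendsto_fpsI)
    fix n
    show "\<forall>\<^sub>F N in sequentially. fps_nth (\<Prod>i\<le>N. 1 - fps_X ^ (k * Suc i)) n = fps_nth L n"
      using eventually_ge_at_top[of n]
    proof eventually_elim
      case (elim N)
      thus ?case
        using eulerf_partial_prod_nth_stable[OF assms(1) elim] by (simp add: L_def)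
    qed
  qed
  moreover have "L \<noteq> 0"
    using 0 by auto
  ultimately show "(\<lambda>i. 1 - fps_X ^ (k * Suc i)) has_prod L"
    by (simp add: has_prod_def raw_has_prod_def)
qed

lemma eulerf_has_prod:
  assumes "k > 0"
  shows "(\<lambda>i. 1 - fps_X ^ (k * Suc i)) has_prod eulerf k"
  using eulerf_aux(1)[OF assms] has_prod_unique[OF eulerf_aux(1)[OF assms]]
  by (simp only: eulerf_def)

lemma eulerf_nth_0 [simp]:
  assumes "k > 0"
  shows "fps_nth (eulerf k) 0 = 1"
  using eulerf_aux(2)[OF assms] has_prod_unique[OF eulerf_aux(1)[OF assms]]
  by (simp only: eulerf_def)

text \<open>
  Division of formal power series is only available over a field in the library, so
  the quotient over the integers is written with the ring-level inverse
  \<open>fps_right_inverse\<close>, whose second argument is the inverse of the constant term.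
\<close>

definition M :: "nat \<Rightarrow> int" where
  "M n = fps_nth (eulerf 2 ^ 5 * eulerf 5 ^ 5 * fps_right_inverse (eulerf 1 * eulerf 10) 1) n"

lemma M_mult_denominator:
  "Abs_fps M * (eulerf 1 * eulerf 10) = eulerf 2 ^ 5 * eulerf 5 ^ 5"
proof -
  have "Abs_fps M = eulerf 2 ^ 5 * eulerf 5 ^ 5 * fps_right_inverse (eulerf 1 * eulerf 10) 1"
    by (rule fps_ext) (simp add: M_def)
  moreover have "eulerf 1 * eulerf 10 * fps_right_inverse (eulerf 1 * eulerf 10) 1 = 1"
    by (rule fps_right_inverse) simp
  ultimately show ?thesis
    by (simp only: mult.assoc mult.commute[of "fps_right_inverse _ _"] mult.right_neutral)
qed

end

theory Submission
  imports Defs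
begin

text \<open>
  With \<open>\<psi>(q) = f\<^sub>2\<^sup>2 / f\<^sub>1\<close> and \<open>\<phi>(-q) = f\<^sub>1\<^sup>2 / f\<^sub>2\<close> the generating function of \<open>M\<close> factors as
  \<open>\<psi>(q) f\<^sub>2\<^sup>3 \<sqdot> \<phi>(-q\<^sup>5) f\<^sub>5\<^sup>3\<close>. Each factor is a theta series by identities of Gauss and
  Jacobi: \<open>\<psi>\<close> and \<open>f\<^sub>1\<^sup>3\<close> live on the triangular numbers \<open>m (m + 1) / 2\<close>, the latter with
  coefficients \<open>\<plusminus>(2m + 1)\<close>, and \<open>\<phi>\<close> lives on the squares.

  The exponents \<open>e\<close> in \<open>q \<psi>(q) f\<^sub>2\<^sup>3\<close> satisfy \<open>8e = (2k + 1)\<^sup>2 + 2 (2m + 1)\<^sup>2 + 5\<close>. Since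
  \<open>-2\<close> is not a square modulo 5, \<open>e\<close> is divisible by 5 only if both \<open>2k + 1\<close> and \<open>2m + 1\<close>
  are. Up to a power of \<open>q\<close>, these terms form a series of the same shape with \<open>q\<close> replaced by its
  25th power, and the coefficient \<open>2m + 1\<close> contributes a factor 5. Hence the \<open>M (5n + 4)\<close> are the coefficients of
  \<open>5q\<close> times the companion series \<open>\<phi>(-q) f\<^sub>1\<^sup>3 \<sqdot> \<psi>(q\<^sup>5) f\<^bsub>10\<^esub>\<^sup>3\<close> (\<open>M_section\<close>). The form
  \<open>8z\<^sup>2 + (2w + 1)\<^sup>2\<close> that belongs to \<open>\<phi>(-q) f\<^sub>1\<^sup>3\<close> is anisotropic modulo 5 as well, so
  the same argument leads from the companion back to \<open>M\<close>, with another factor 5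
  (\<open>companion_section\<close>). Together these give \<open>M (25n + 24) = 25 M n\<close>, and an induction on
  \<open>\<alpha>\<close> in steps of two finishes the proof.

  The three theta identities come from one argument (\<open>theta_product_tendsto\<close>). The sum of the
  theta terms weighted by the Gaussian binomial coefficients \<open>[2n + d, j]\<close> gains a factor
  \<open>(1 \<plusminus> q\<^sup>s)\<^sup>2\<close>, where \<open>s\<close> depends on \<open>n\<close>, when \<open>n\<close> grows by one; so it is a finite product.
  As \<open>n\<close> grows, the weights tend to the reciprocal of an Euler product.
\<close>

unbundle no vec_syntax
unbundle fps_syntax

section \<open>Limits of formal power series\<close>

lemma tendsto_fps_mult:
  fixes A B :: "'b \<Rightarrow> 'a::comm_ring_1 fps"
  assumes "(A \<longlongrightarrow> a) F" and "(B \<longlongrightarrow> b) F"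
  shows "((\<lambda>x. A x * B x) \<longlongrightarrow> a * b) F"
proof (rule tendsto_fpsI)
  fix n
  have "\<forall>\<^sub>F x in F. \<forall>i\<in>{..n}. A x $ i = a $ i \<and> B x $ i = b $ i"
    using assms by (subst eventually_ball_finite_distrib) (auto simp: tendsto_fps_iff eventually_conj)
  thus "\<forall>\<^sub>F x in F. (A x * B x) $ n = (a * b) $ n"
    by eventually_elim (auto simp: fps_mult_nth intro!: sum.cong)
qed

lemma tendsto_fps_power:
  fixes A :: "'b \<Rightarrow> 'a::comm_ring_1 fps"
  assumes "(A \<longlongrightarrow> a) F"
  shows "((\<lambda>x. A x ^ k) \<longlongrightarrow> a ^ k) F"
  by (induction k) (auto intro!: tendsto_fps_mult assms)

lemma eulerf_nonzero:
  assumes "b > 0"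
  shows "eulerf b \<noteq> 0"
proof
  assume "eulerf b = 0"
  thus False using eulerf_nth_0[OF assms] by simp
qed

text \<open>
  The factors are powers of \<open>fps_X ^ b\<close>, so that this is the \<open>q\<close>-Pochhammer symbol
  \<open>(p; p)\<^sub>n\<close> at \<open>p = fps_X ^ b\<close>, the form in which Gaussian binomial coefficients produce it.
\<close>

definition partial_euler :: "nat \<Rightarrow> nat \<Rightarrow> int fps" where
  "partial_euler b n = (\<Prod>i<n. 1 - (fps_X ^ b) ^ Suc i)"

lemma partial_euler_tendsto:
  assumes "b > 0"
  shows "partial_euler b \<longlonglongrightarrow> eulerf b"
proof -
  have "(\<lambda>n. \<Prod>i\<le>n. 1 - fps_X ^ (b * Suc i)) \<longlonglongrightarrow> eulerf b"
    using eulerf_has_prod[OF assms] eulerf_nonzero[OF assms]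
    by (simp add: has_prod_def raw_has_prod_def)
  hence "(\<lambda>n. partial_euler b (Suc n)) \<longlonglongrightarrow> eulerf b"
    by (simp add: partial_euler_def lessThan_Suc_atMost power_mult del: power_Suc mult_Suc_right)
  thus ?thesis by (rule LIMSEQ_imp_Suc)
qed

lemma partial_euler_nth_stable:
  assumes "b > 0" and "i < N"
  shows "partial_euler b N $ i = eulerf b $ i"
proof -
  have *: "partial_euler b N' $ i = partial_euler b (Suc i) $ i" if "N' > i" for N'
  proof -
    obtain M where "N' = Suc M" "i \<le> M" using \<open>N' > i\<close> by (metis Suc_le_D Suc_leI Suc_le_mono)
    thus ?thesis
      using eulerf_partial_prod_nth_stable[OF assms(1), of i M]
      by (simp add: partial_euler_def lessThan_Suc_atMost power_mult
               del: power_Suc prod.atMost_Suc mult_Suc_right)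
  qed
  have "\<forall>\<^sub>F n in sequentially. partial_euler b n $ i = eulerf b $ i"
    using partial_euler_tendsto[OF assms(1)] by (auto simp: tendsto_fps_iff)
  hence "\<forall>\<^sub>F n in sequentially. eulerf b $ i = partial_euler b (Suc i) $ i"
    using eventually_gt_at_top[of i] by eventually_elim (metis *)
  hence "eulerf b $ i = partial_euler b (Suc i) $ i" by simp
  thus ?thesis by (simp only: *[OF assms(2)])
qed

section \<open>Gaussian binomial coefficients\<close>

fun gauss_binomial :: "'a::comm_ring_1 \<Rightarrow> nat \<Rightarrow> nat \<Rightarrow> 'a" where
  "gauss_binomial p N 0 = 1"
| "gauss_binomial p 0 (Suc j) = 0"
| "gauss_binomial p (Suc N) (Suc j) = gauss_binomial p N j + p ^ Suc j * gauss_binomial p N (Suc j)"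

lemma gauss_binomial_eq_0: "N < j \<Longrightarrow> gauss_binomial p N j = 0"
  by (induction p N j rule: gauss_binomial.induct) auto

lemma gauss_binomial_self [simp]: "gauss_binomial p n n = 1"
  by (induction n) (auto simp: gauss_binomial_eq_0)

text \<open>
  The second Pascal rule, with the power of \<open>p\<close> on the other summand than in the definition.
  It is the combination of both rules that makes \<open>sum_gauss_binomial_Suc_Suc\<close> symmetric.
\<close>

lemma gauss_binomial_pascal:
  "j \<le> N \<Longrightarrow> gauss_binomial p (Suc N) (Suc j)
     = p ^ (N - j) * gauss_binomial p N j + gauss_binomial p N (Suc j)"
proof (induction N arbitrary: j)
  case (Suc N)
  show ?case
  proof (cases j)
    case 0
    have "gauss_binomial p (Suc (Suc N)) (Suc 0)
            = 1 + p * gauss_binomial p (Suc N) (Suc 0)" by simp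
    also have "gauss_binomial p (Suc N) (Suc 0) = p ^ N + gauss_binomial p N (Suc 0)"
      using Suc.IH[of 0] by simp
    also have "1 + p * (p ^ N + gauss_binomial p N (Suc 0))
               = p ^ Suc N + gauss_binomial p (Suc N) (Suc 0)"
      by (simp add: algebra_simps)
    finally show ?thesis using 0 by simp
  next
    case (Suc i)
    hence i: "i < Suc N" using Suc.prems by simp
    show ?thesis
    proof (cases "j \<le> N")
      case True
      have "Suc j + (N - j) = Suc N" using True by simp
      have 1: "gauss_binomial p (Suc N) (Suc i) = p ^ (N - i) * gauss_binomial p N i + gauss_binomial p N (Suc i)"
        using Suc.IH[of i] i by simp
      have 2: "gauss_binomial p (Suc N) (Suc j) = p ^ (N - j) * gauss_binomial p N j + gauss_binomial p N (Suc j)"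
        using Suc.IH[OF True] .
      have e: "N - i = Suc (N - j)" using True Suc by simp
      have "gauss_binomial p (Suc (Suc N)) (Suc j)
         = gauss_binomial p (Suc N) (Suc i) + p ^ Suc j * gauss_binomial p (Suc N) (Suc j)"
        using Suc by simp
      also have "\<dots> = p ^ (N - i) * (gauss_binomial p N i + p ^ j * gauss_binomial p N j)
                     + (gauss_binomial p N j + p ^ Suc j * gauss_binomial p N (Suc j))"
        unfolding 1 2 e using Suc by (simp add: algebra_simps)
      also have "\<dots> = p ^ (N - i) * gauss_binomial p (Suc N) j + gauss_binomial p (Suc N) (Suc j)"
        using Suc by simp
      finally show ?thesis using Suc by simp
    next
      case False
      hence "j = Suc N" using Suc.prems by simp
      thus ?thesis by (simp add: gauss_binomial_eq_0)
    qed
  qed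
qed simp

lemma sum_gauss_binomial_Suc:
  "(\<Sum>j\<le>Suc N. w j * gauss_binomial p (Suc N) j)
     = (\<Sum>j\<le>N. (w (Suc j) + p ^ j * w j) * gauss_binomial p N j)" (is ?th1)
  "(\<Sum>j\<le>Suc N. w j * gauss_binomial p (Suc N) j)
     = (\<Sum>j\<le>N. (p ^ (N - j) * w (Suc j) + w j) * gauss_binomial p N j)" (is ?th2)
proof -
  have sh: "(\<Sum>j\<le>N. f j * gauss_binomial p N j)
      = f 0 + (\<Sum>j\<le>N. f (Suc j) * gauss_binomial p N (Suc j))" for f
    using sum.atMost_Suc_shift[of "\<lambda>j. f j * gauss_binomial p N j" N]
    by (simp add: gauss_binomial_eq_0)
  have S: "(\<Sum>j\<le>Suc N. w j * gauss_binomial p (Suc N) j)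
     = w 0 + (\<Sum>j\<le>N. w (Suc j) * gauss_binomial p (Suc N) (Suc j))"
    by (subst sum.atMost_Suc_shift) simp
  show ?th1
    unfolding S using sh[of "\<lambda>j. p ^ j * w j"]
    by (simp add: algebra_simps sum.distrib)
  have "(\<Sum>j\<le>N. w (Suc j) * gauss_binomial p (Suc N) (Suc j))
      = (\<Sum>j\<le>N. w (Suc j) * (p ^ (N - j) * gauss_binomial p N j + gauss_binomial p N (Suc j)))"
    by (intro sum.cong refl arg_cong2[where f = "(*)"] gauss_binomial_pascal) simp
  thus ?th2
    unfolding S using sh[of w]
    by (simp add: algebra_simps sum.distrib)
qed

text \<open>
  Raising the upper index by two replaces the weights \<open>w\<close> by a combination of three
  neighbours. The assumption says that the two outer neighbours add up to a multiple of the middle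
  one, as they do for theta terms; then the whole sum merely picks up a factor.
\<close>

lemma sum_gauss_binomial_Suc_Suc:
  assumes "\<And>j. j \<le> N \<Longrightarrow> p ^ (N - j) * w (j + 2) + p ^ j * w j = \<mu> * w (Suc j)"
  shows "(\<Sum>j\<le>Suc (Suc N). w j * gauss_binomial p (Suc (Suc N)) j)
          = (1 + \<mu> + p ^ Suc N) * (\<Sum>j\<le>N. w (Suc j) * gauss_binomial p N j)"
proof -
  have "(\<Sum>j\<le>Suc (Suc N). w j * gauss_binomial p (Suc (Suc N)) j)
      = (\<Sum>j\<le>N. (p ^ (N - j) * (w (j + 2) + p ^ Suc j * w (Suc j)) + (w (Suc j) + p ^ j * w j))
           * gauss_binomial p N j)"
    by (subst sum_gauss_binomial_Suc(1), subst sum_gauss_binomial_Suc(2)) simp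
  also have "\<dots> = (\<Sum>j\<le>N. (1 + \<mu> + p ^ Suc N) * (w (Suc j) * gauss_binomial p N j))"
  proof (intro sum.cong refl)
    fix j assume "j \<in> {..N}"
    hence j: "j \<le> N" by simp
    have "p ^ (N - j) * p ^ Suc j = p ^ Suc N"
      using j by (simp add: power_add[symmetric] del: power_Suc)
    hence "p ^ (N - j) * (w (j + 2) + p ^ Suc j * w (Suc j)) + (w (Suc j) + p ^ j * w j)
        = (p ^ (N - j) * w (j + 2) + p ^ j * w j) + (1 + p ^ Suc N) * w (Suc j)"
      by (simp add: distrib_left distrib_right mult.assoc[symmetric] add_ac del: power_Suc)
    also have "\<dots> = (1 + \<mu> + p ^ Suc N) * w (Suc j)"
      unfolding assms[OF j] by (simp add: algebra_simps)
    finally show "(p ^ (N - j) * (w (j + 2) + p ^ Suc j * w (Suc j)) + (w (Suc j) + p ^ j * w j))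
           * gauss_binomial p N j = (1 + \<mu> + p ^ Suc N) * (w (Suc j) * gauss_binomial p N j)"
      by (simp add: mult.assoc)
  qed
  finally show ?thesis by (simp add: sum_distrib_left)
qed

text \<open>
  The quotient formula \<open>[a + b, a] = (p; p)\<^bsub>a+b\<^esub> / ((p; p)\<^sub>a (p; p)\<^sub>b)\<close>, kept free of
  division. It shows that the coefficient tends to \<open>1 / (p; p)\<^sub>\<infinity>\<close> when both \<open>a\<close> and \<open>b\<close> grow.
\<close>

lemma gauss_binomial_mult_prod:
  fixes p :: "'a::comm_ring_1"
  defines "P \<equiv> \<lambda>n. \<Prod>i<n. 1 - p ^ Suc i"
  shows "gauss_binomial p (a + b) a * P a * P b = P (a + b)"
proof (induction "a + b" arbitrary: a b)
  case 0
  thus ?case by (simp add: P_def)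
next
  case (Suc N)
  have PS: "P (Suc n) = P n * (1 - p ^ Suc n)" for n
    by (simp add: P_def)
  show ?case
  proof (cases a; cases b)
    fix a' b' assume ab: "a = Suc a'" "b = Suc b'"
    have N: "N = a' + b" "N = a + b'" "N = Suc (a' + b')" using Suc.hyps(2) ab by auto
    have 1: "gauss_binomial p N a' * P a' * P b = P N"
      using Suc.hyps(1)[OF N(1)] N(1) by simp
    have 2: "gauss_binomial p N a * P a * P b' = P N"
      using Suc.hyps(1)[OF N(2)] N(2) by simp
    have "gauss_binomial p (Suc N) a * P a * P b
        = (gauss_binomial p N a' * P a' * P b) * (1 - p ^ a)
          + p ^ a * (gauss_binomial p N a * P a * P b') * (1 - p ^ b)"
      unfolding ab by (simp add: PS algebra_simps)
    also have "\<dots> = P N * (1 - p ^ (a + b))"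
      unfolding 1 2 by (simp add: algebra_simps power_add)
    also have "\<dots> = P (Suc N)" using PS[of N] Suc.hyps(2) by simp
    finally show ?thesis using Suc.hyps(2) by simp
  qed (use Suc.hyps(2) in \<open>auto simp: P_def\<close>)
qed


section \<open>Theta series\<close>

text \<open>
  The series \<open>\<Sum>k. a k * q ^ e k\<close> over all integers \<open>k\<close>. It is given by its coefficients, which is
  sensible if \<open>e\<close> takes each value only finitely often.
\<close>

definition theta :: "(int \<Rightarrow> int) \<Rightarrow> (int \<Rightarrow> nat) \<Rightarrow> int fps" where
  "theta a e = Abs_fps (\<lambda>i. \<Sum>k | e k = i. a k)"

text \<open>
  Up to degree \<open>i\<close> all of \<open>(p; p)\<^sub>j\<close>, \<open>(p; p)\<^bsub>N-j\<^esub>\<close> and \<open>(p; p)\<^sub>N\<close> agree with the Euler product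
  \<open>f\<close>, so the quotient formula reads \<open>[N, j] f f = f\<close>, and \<open>f\<close> can be cancelled.
\<close>

lemma eulerf_mult_gauss_binomial_nth:
  assumes "b > 0" and "j \<le> N" and "i < j" and "i < N - j"
  shows "(eulerf b * gauss_binomial (fps_X ^ b) N j) $ i = 1 $ i"
proof -
  define f where "f = eulerf b"
  define g where "g = gauss_binomial (fps_X ^ b :: int fps) N j"
  define h where "h = fps_right_inverse f 1"
  define P where "P = partial_euler b"
  have fh: "f * h = 1"
    unfolding h_def by (rule fps_right_inverse) (simp add: f_def assms(1))
  have st: "P n $ l = f $ l" if "l \<le> i" "i < n" for l n
    unfolding P_def f_def using partial_euler_nth_stable[OF assms(1)] that by simp
  have prod: "g * P j * P (N - j) = P N"
    using gauss_binomial_mult_prod[of "fps_X ^ b :: int fps" j "N - j"] assms(2)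
    by (simp add: g_def P_def partial_euler_def)
  have eq_mult: "\<And>l. l \<le> i \<Longrightarrow> (A * C) $ l = (B * D) $ l"
    if "\<And>l. l \<le> i \<Longrightarrow> A $ l = B $ l" "\<And>l. l \<le> i \<Longrightarrow> C $ l = D $ l" for A B C D :: "int fps"
    using that by (auto simp: fps_mult_nth intro!: sum.cong)
  have "h * (g * f * f) = (f * h) * (f * g)" by (simp only: mult_ac)
  hence "(f * g) $ i = (h * (g * f * f)) $ i" by (simp only: fh mult_1)
  \<comment> \<open>Degrees above \<open>i\<close> do not enter, so \<open>f\<close> may be traded for the finite products and back.\<close>
  also have "(h * (g * f * f)) $ i = (h * (g * P j * P (N - j))) $ i"
    by (intro eq_mult[of h h "g * f * f"] eq_mult[of "g * f"] eq_mult[of g g]) 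
       (use st assms in auto)
  also have "\<dots> = (h * P N) $ i" unfolding prod ..
  also have "\<dots> = (h * f) $ i"
    by (intro eq_mult[of h h]) (use st assms in auto)
  finally show ?thesis using fh by (simp add: f_def g_def mult.commute)
qed

text \<open>
  In a fixed degree \<open>i\<close> only the finitely many \<open>k = n - j\<close> with \<open>e k \<le> i\<close> matter. For large \<open>n\<close>
  the corresponding \<open>j\<close> are far from both ends of the summation range, where the Gaussian binomial
  coefficient cancels against the Euler product.
\<close>

lemma theta_tendsto:
  fixes a :: "int \<Rightarrow> int" and e :: "int \<Rightarrow> nat"
  assumes "b > 0" and growth: "\<And>k. \<bar>k\<bar> \<le> int (e k) + 1"
  shows "(\<lambda>n. eulerf b * (\<Sum>j\<le>2 * n + d. fps_const (a (int n - int j)) * fps_X ^ e (int n - int j)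
               * gauss_binomial (fps_X ^ b) (2 * n + d) j)) \<longlonglongrightarrow> theta a e"
    (is "?W \<longlonglongrightarrow> _")
proof (rule tendsto_fpsI)
  fix i
  show "\<forall>\<^sub>F n in sequentially. ?W n $ i = theta a e $ i"
    using eventually_ge_at_top[of "2 * i + 2"]
  proof eventually_elim
    case (elim n)
    define k where "k = (\<lambda>j. int n - int j)"
    define g where "g = (\<lambda>j. eulerf b * gauss_binomial (fps_X ^ b) (2 * n + d) j)"
    have term_nth: "(fps_const (a (k j)) * (fps_X ^ e (k j) * g j)) $ i = (if e (k j) = i then a (k j) else 0)"
      if "j \<le> 2 * n + d" for j
    proof (cases "e (k j) \<le> i")
      case True
      hence "\<bar>int n - int j\<bar> \<le> int i + 1" using growth[of "k j"] by (simp add: k_def)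
      hence "i < j" "i < 2 * n + d - j" using elim that by linarith+
      hence "g j $ (i - e (k j)) = 1 $ (i - e (k j))"
        unfolding g_def using that by (intro eulerf_mult_gauss_binomial_nth assms) auto
      thus ?thesis using True by (auto simp: fps_X_power_mult_nth)
    qed (auto simp: fps_X_power_mult_nth)
    have "?W n = (\<Sum>j\<le>2 * n + d. fps_const (a (k j)) * (fps_X ^ e (k j) * g j))"
      unfolding sum_distrib_left g_def k_def by (intro sum.cong) (simp_all add: mult_ac)
    hence "?W n $ i = (\<Sum>j\<le>2 * n + d. if e (k j) = i then a (k j) else 0)"
      using term_nth by (simp add: fps_sum_nth)
    also have "\<dots> = (\<Sum>j | j \<le> 2 * n + d \<and> e (k j) = i. a (k j))"
      by (subst sum.inter_filter[symmetric]) auto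
    also have "\<dots> = (\<Sum>l | e l = i. a l)"
    proof (rule sum.reindex_bij_witness[of _ "\<lambda>l. nat (int n - l)" k])
      fix l assume "l \<in> {l. e l = i}"
      hence "\<bar>l\<bar> \<le> int i + 1" "e l = i" using growth[of l] by auto
      moreover from this have "l \<le> int n" "- l \<le> int n" using elim by linarith+
      ultimately show "k (nat (int n - l)) = l" 
        "nat (int n - l) \<in> {j. j \<le> 2 * n + d \<and> e (k j) = i}"
        by (auto simp: k_def)
    qed (auto simp: k_def)
    finally show ?case by (simp add: theta_def)
  qed
qed

text \<open>
  The common source of the three theta identities. The conditions on \<open>exps\<close> and \<open>rec\<close> make the
  theta terms \<open>a k * q ^ e k\<close> fulfil the three-term relation of \<open>sum_gauss_binomial_Suc_Suc\<close> with
  \<open>\<mu> = 2\<sigma> q ^ s n\<close>, and by the condition on \<open>s\<close> the resulting factor is a perfect square,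
  \<open>1 + 2\<sigma> q ^ s n + q ^ (2 * s n) = (1 + \<sigma> q ^ s n)\<^sup>2\<close>. The parity \<open>d\<close> of the upper index is 1 for
  exponents symmetric about \<open>-1/2\<close> (triangular numbers) and 0 for exponents symmetric about 0
  (squares).
\<close>

lemma theta_product_tendsto:
  fixes a :: "int \<Rightarrow> int" and e :: "int \<Rightarrow> nat" and \<sigma> :: int
  assumes "b > 0" and "\<And>k. \<bar>k\<bar> \<le> int (e k) + 1"
    and rec: "\<And>k. a (k - 1) + a (k + 1) = 2 * \<sigma> * a k" and \<sigma>: "\<sigma> * \<sigma> = 1"
    and exps: "\<And>n j. j \<le> 2 * n + d \<Longrightarrow>
             b * (2 * n + d - j) + e (int n - int j - 1) = e (int n - int j) + s n"
          "\<And>n j. j \<le> 2 * n + d \<Longrightarrow> b * j + e (int n - int j + 1) = e (int n - int j) + s n"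
    and s: "\<And>n. 2 * s n = b * Suc (2 * n + d)"
  defines "c \<equiv> \<Sum>j\<le>d. fps_const (a (- int j)) * fps_X ^ e (- int j) * gauss_binomial (fps_X ^ b) d j"
  shows "(\<lambda>n. eulerf b * (c * (\<Prod>i<n. 1 + fps_const \<sigma> * fps_X ^ s i) ^ 2)) \<longlonglongrightarrow> theta a e"
proof -
  define v where "v = (\<lambda>k. fps_const (a k) * fps_X ^ e k :: int fps)"
  define W where "W = (\<lambda>n. \<Sum>j\<le>2 * n + d. v (int n - int j) * gauss_binomial (fps_X ^ b) (2 * n + d) j)"
  have step: "W (Suc n) = (1 + fps_const \<sigma> * fps_X ^ s n) ^ 2 * W n" for n
  proof -
    \<comment> \<open>Weights for the sum at \<open>n + 1\<close>; shifted by one in \<open>j\<close> they are those for the sum at \<open>n\<close>.\<close>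
    define w where "w = (\<lambda>j. v (int n + 1 - int j))"
    define N where "N = 2 * n + d"
    define \<mu> :: "int fps" where "\<mu> = fps_const (2 * \<sigma>) * fps_X ^ s n"
    have "(fps_X ^ b) ^ (N - j) * w (j + 2) + (fps_X ^ b) ^ j * w j = \<mu> * w (Suc j)"
      if "j \<le> N" for j
    proof -
      define k where "k = int n - int j"
      have "(fps_X ^ b) ^ (N - j) * w (j + 2) = fps_const (a (k - 1)) * fps_X ^ (e k + s n)"
        using exps(1)[of j n] that
        by (simp add: w_def v_def N_def k_def power_mult[symmetric] power_add[symmetric] mult.left_commute
                      algebra_simps)
      moreover have "(fps_X ^ b) ^ j * w j = fps_const (a (k + 1)) * fps_X ^ (e k + s n)"
        using exps(2)[of j n] that
        by (simp add: w_def v_def N_def k_def power_mult[symmetric] power_add[symmetric] mult.left_commute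
                      algebra_simps)
      moreover have "\<mu> * w (Suc j) = fps_const (2 * \<sigma> * a k) * fps_X ^ (e k + s n)"
        by (simp add: \<mu>_def w_def v_def k_def power_add algebra_simps flip: fps_const_mult)
      ultimately show ?thesis
        unfolding rec[of k, symmetric] by (simp add: distrib_right flip: fps_const_add)
    qed
    hence "(\<Sum>j\<le>Suc (Suc N). w j * gauss_binomial (fps_X ^ b) (Suc (Suc N)) j)
        = (1 + \<mu> + (fps_X ^ b) ^ Suc N) * (\<Sum>j\<le>N. w (Suc j) * gauss_binomial (fps_X ^ b) N j)"
      by (rule sum_gauss_binomial_Suc_Suc)
    moreover have "1 + \<mu> + (fps_X ^ b) ^ Suc N = (1 + fps_const \<sigma> * fps_X ^ s n) ^ 2"
    proof -
      have "(fps_X ^ b) ^ Suc N = (fps_X ^ s n * fps_X ^ s n :: int fps)"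
        using s[of n] by (simp add: N_def power_mult[symmetric] power_add[symmetric] mult_2 del: power_Suc)
      moreover have "(1 + fps_const \<sigma> * x) ^ 2
          = 1 + 2 * fps_const \<sigma> * x + (fps_const \<sigma> * fps_const \<sigma>) * (x * x)" for x
        by (simp add: power2_eq_square algebra_simps del: fps_const_mult)
      moreover have "fps_const \<sigma> * fps_const \<sigma> = 1" using \<sigma> by simp
      moreover have "\<mu> = 2 * fps_const \<sigma> * fps_X ^ s n"
        by (simp add: \<mu>_def numeral_fps_const)
      ultimately show ?thesis by simp
    qed
    moreover have "(\<Sum>j\<le>Suc (Suc N). w j * gauss_binomial (fps_X ^ b) (Suc (Suc N)) j) = W (Suc n)"
      by (simp add: W_def w_def N_def add.commute)
    moreover have "(\<Sum>j\<le>N. w (Suc j) * gauss_binomial (fps_X ^ b) N j) = W n"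
      by (simp add: W_def w_def N_def)
    ultimately show ?thesis by simp
  qed
  have "W n = c * (\<Prod>i<n. 1 + fps_const \<sigma> * fps_X ^ s i) ^ 2" for n
  proof (induction n)
    case 0
    show ?case by (simp add: W_def c_def v_def)
  next
    case (Suc n)
    thus ?case unfolding step by (simp add: power_mult_distrib mult_ac)
  qed
  thus ?thesis
    using theta_tendsto[OF assms(1,2), where d = d and a = a] by (simp add: W_def v_def)
qed


section \<open>The theta identities of Gauss and Jacobi\<close>

definition triangular :: "int \<Rightarrow> nat" where
  "triangular k = nat (k * (k + 1) div 2)"

lemma two_triangular: "2 * int (triangular k) = k * (k + 1)"
proof -
  have "k * (k + 1) \<ge> 0" by (cases "k \<ge> 0") (auto intro: mult_nonpos_nonpos)
  thus ?thesis by (simp add: triangular_def)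
qed

definition alt_sign :: "int \<Rightarrow> int" where
  "alt_sign k = (if even k then 1 else - 1)"

text \<open>
  Every triangular number is attained by exactly two integers, \<open>k\<close> and \<open>-1 - k\<close>, with equal
  coefficients. Summing over all integers therefore gives twice the series \<open>\<psi>(q\<^sup>b)\<close> here, and twice
  the series for \<open>f\<^sub>b\<^sup>3\<close> in the next definition.
\<close>

definition double_psi :: "nat \<Rightarrow> int fps" where
  "double_psi b = theta (\<lambda>_. 1) (\<lambda>k. b * triangular k)"

definition double_cube :: "nat \<Rightarrow> int fps" where
  "double_cube b = theta (\<lambda>k. alt_sign k * (2 * k + 1)) (\<lambda>k. b * triangular k)"

text \<open>
  This is \<open>\<phi>(-q\<^sup>b)\<close>.
\<close>

definition phi :: "nat \<Rightarrow> int fps" where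
  "phi b = theta alt_sign (\<lambda>k. b * nat (k ^ 2))"

lemma triangular_pred: "int (triangular (k - 1)) = int (triangular k) - k"
  and triangular_succ: "int (triangular (k + 1)) = int (triangular k) + k + 1"
  using two_triangular[of k] two_triangular[of "k - 1"] two_triangular[of "k + 1"]
  by (simp_all add: algebra_simps)

lemma abs_le_triangular: "\<bar>k\<bar> \<le> int (triangular k) + 1"
proof -
  have "2 * \<bar>k\<bar> \<le> k * (k + 1) + 2"
  proof (cases "k \<ge> 0")
    case True
    have "0 \<le> (k - 1) * k" using True by (cases "k = 0") auto
    thus ?thesis using True by (simp add: algebra_simps)
  next
    case False
    hence "0 \<le> (k + 1) * (k + 2)" by (cases "k = -1") (auto intro: mult_nonpos_nonpos)
    thus ?thesis using False by (simp add: algebra_simps)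
  qed
  thus ?thesis using two_triangular[of k] by linarith
qed

lemma abs_le_square: "\<bar>k\<bar> \<le> int (nat (k ^ 2)) + 1"
proof -
  have "0 \<le> (\<bar>k\<bar> - 1) ^ 2" by simp
  hence "2 * \<bar>k\<bar> \<le> k ^ 2 + 1" by (simp add: power2_eq_square algebra_simps)
  thus ?thesis by simp
qed

lemma le_mult_growth:
  assumes "b > 0" "\<bar>k\<bar> \<le> int x + 1"
  shows "\<bar>k\<bar> \<le> int (b * x) + 1"
proof -
  have "1 * x \<le> b * x" using assms(1) by (intro mult_le_mono1) simp
  thus ?thesis using assms(2) by linarith
qed

lemma triangular_exponents:
  assumes "j \<le> 2 * n + 1"
  shows "b * (2 * n + 1 - j) + b * triangular (int n - int j - 1)
           = b * triangular (int n - int j) + b * Suc n"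
    and "b * j + b * triangular (int n - int j + 1) = b * triangular (int n - int j) + b * Suc n"
proof -
  have "2 * n + 1 - j + triangular (int n - int j - 1) = triangular (int n - int j) + Suc n"
    using triangular_pred[of "int n - int j"] assms by linarith
  thus "b * (2 * n + 1 - j) + b * triangular (int n - int j - 1)
           = b * triangular (int n - int j) + b * Suc n"
    by (simp only: distrib_left[symmetric])
  have "j + triangular (int n - int j + 1) = triangular (int n - int j) + Suc n"
    using triangular_succ[of "int n - int j"] assms by linarith
  thus "b * j + b * triangular (int n - int j + 1) = b * triangular (int n - int j) + b * Suc n"
    by (simp only: distrib_left[symmetric])
qed

lemma square_exponents:
  assumes "j \<le> 2 * n"
  shows "2 * b * (2 * n - j) + b * nat ((int n - int j - 1) ^ 2)
           = b * nat ((int n - int j) ^ 2) + b * Suc (2 * n)"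
    and "2 * b * j + b * nat ((int n - int j + 1) ^ 2) = b * nat ((int n - int j) ^ 2) + b * Suc (2 * n)"
proof -
  define k where "k = int n - int j"
  have "(k - 1) ^ 2 = k ^ 2 - 2 * k + 1" "(k + 1) ^ 2 = k ^ 2 + 2 * k + 1"
    by (simp_all add: power2_eq_square algebra_simps)
  moreover have "int (nat (x ^ 2)) = x ^ 2" for x :: int by simp
  ultimately have sq: "int (nat ((k - 1) ^ 2)) = int (nat (k ^ 2)) - 2 * k + 1"
      "int (nat ((k + 1) ^ 2)) = int (nat (k ^ 2)) + 2 * k + 1"
    by metis+
  have "2 * (2 * n - j) + nat ((k - 1) ^ 2) = nat (k ^ 2) + Suc (2 * n)"
    using sq(1) assms k_def by linarith
  hence "b * (2 * (2 * n - j) + nat ((k - 1) ^ 2)) = b * (nat (k ^ 2) + Suc (2 * n))" by simp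
  thus "2 * b * (2 * n - j) + b * nat ((int n - int j - 1) ^ 2)
           = b * nat ((int n - int j) ^ 2) + b * Suc (2 * n)"
    by (simp only: distrib_left k_def mult_ac)
  have "2 * j + nat ((k + 1) ^ 2) = nat (k ^ 2) + Suc (2 * n)"
    using sq(2) assms k_def by linarith
  hence "b * (2 * j + nat ((k + 1) ^ 2)) = b * (nat (k ^ 2) + Suc (2 * n))" by simp
  thus "2 * b * j + b * nat ((int n - int j + 1) ^ 2) = b * nat ((int n - int j) ^ 2) + b * Suc (2 * n)"
    by (simp only: distrib_left k_def mult_ac)
qed

lemma triangular_0_neg1 [simp]: "triangular 0 = 0" "triangular (- 1) = 0"
  by (simp_all add: triangular_def)

lemma alt_sign_shift: "alt_sign (k - 1) = - alt_sign k" "alt_sign (k + 1) = - alt_sign k"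
  by (auto simp: alt_sign_def)

text \<open>
  Jacobi's identity. The coefficients \<open>(-1)\<^sup>k (2k + 1)\<close> satisfy the same recurrence as \<open>(-1)\<^sup>k\<close>,
  because \<open>2k + 1\<close> is an arithmetic progression; so the derivative in the usual proof from the
  triple product is avoided.
\<close>

lemma double_cube_eq:
  assumes "b > 0"
  shows "double_cube b = 2 * eulerf b ^ 3"
proof -
  define c where "c = (\<Sum>j\<le>1. fps_const (alt_sign (- int j) * (2 * (- int j) + 1))
      * fps_X ^ (b * triangular (- int j)) * gauss_binomial (fps_X ^ b) 1 j :: int fps)"
  have c: "c = 2"
    unfolding c_def by (simp add: alt_sign_def)
  have "(\<lambda>n. eulerf b * (c * (\<Prod>i<n. 1 + fps_const (- 1) * fps_X ^ (b * Suc i)) ^ 2)) \<longlonglongrightarrow> double_cube b"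
    unfolding c_def double_cube_def
  proof (rule theta_product_tendsto)
    show "\<bar>k\<bar> \<le> int (b * triangular k) + 1" for k
      by (rule le_mult_growth[OF assms abs_le_triangular])
    show "alt_sign (k - 1) * (2 * (k - 1) + 1) + alt_sign (k + 1) * (2 * (k + 1) + 1)
        = 2 * - 1 * (alt_sign k * (2 * k + 1))" for k
      unfolding alt_sign_shift by (simp add: algebra_simps)
  qed (use assms triangular_exponents[of _ _ b] in auto)
  moreover have "(\<Prod>i<n. 1 + fps_const (- 1) * fps_X ^ (b * Suc i)) = partial_euler b n" for n
    by (simp add: partial_euler_def power_mult del: power_Suc mult_Suc_right flip: fps_const_neg)
  ultimately have "(\<lambda>n. eulerf b * (2 * partial_euler b n ^ 2)) \<longlonglongrightarrow> double_cube b"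
    by (simp only: c)
  moreover have "(\<lambda>n. eulerf b * (2 * partial_euler b n ^ 2)) \<longlonglongrightarrow> eulerf b * (2 * eulerf b ^ 2)"
    by (intro tendsto_fps_mult tendsto_fps_power partial_euler_tendsto tendsto_const assms)
  ultimately have "double_cube b = eulerf b * (2 * eulerf b ^ 2)"
    by (rule LIMSEQ_unique)
  thus ?thesis by (simp add: eval_nat_numeral mult_ac)
qed

text \<open>
  Gauss's identity for triangular numbers. The limit of the finite products
  \<open>\<Prod>(1 + q\<^sup>i)\<close> is identified through \<open>(1 + q\<^sup>i) (1 - q\<^sup>i) = 1 - q\<^bsup>2i\<^esup>\<close>.
\<close>

lemma double_psi_mult:
  assumes "b > 0"
  shows "double_psi b * eulerf b = 2 * eulerf (2 * b) ^ 2"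
proof -
  define c where "c = (\<Sum>j\<le>1. fps_const 1
      * fps_X ^ (b * triangular (- int j)) * gauss_binomial (fps_X ^ b) 1 j :: int fps)"
  define Q :: "nat \<Rightarrow> int fps" where "Q = (\<lambda>n. \<Prod>i<n. 1 + fps_const 1 * fps_X ^ (b * Suc i))"
  have c: "c = 2"
    unfolding c_def by simp
  have "(\<lambda>n. eulerf b * (c * Q n ^ 2)) \<longlonglongrightarrow> double_psi b"
    unfolding c_def double_psi_def Q_def
  proof (rule theta_product_tendsto)
    show "\<bar>k\<bar> \<le> int (b * triangular k) + 1" for k
      by (rule le_mult_growth[OF assms abs_le_triangular])
  qed (use assms triangular_exponents[of _ _ b] in auto)
  hence "(\<lambda>n. eulerf b * (c * Q n ^ 2) * partial_euler b n ^ 2) \<longlonglongrightarrow> double_psi b * eulerf b ^ 2"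
    by (intro tendsto_fps_mult tendsto_fps_power partial_euler_tendsto assms)
  moreover have "Q n * partial_euler b n = partial_euler (2 * b) n" for n
    unfolding Q_def partial_euler_def prod.distrib[symmetric]
    by (intro prod.cong refl)
       (simp add: power_mult[symmetric] power_add[symmetric] algebra_simps mult_2 del: power_Suc)
  hence "eulerf b * (c * Q n ^ 2) * partial_euler b n ^ 2 = eulerf b * (2 * partial_euler (2 * b) n ^ 2)" for n
    by (simp add: c mult.assoc flip: power_mult_distrib)
  ultimately have "(\<lambda>n. eulerf b * (2 * partial_euler (2 * b) n ^ 2)) \<longlonglongrightarrow> double_psi b * eulerf b ^ 2"
    by simp
  moreover have "(\<lambda>n. eulerf b * (2 * partial_euler (2 * b) n ^ 2)) \<longlonglongrightarrow> eulerf b * (2 * eulerf (2 * b) ^ 2)"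
    using assms by (intro tendsto_fps_mult tendsto_fps_power partial_euler_tendsto tendsto_const) auto
  ultimately have "double_psi b * eulerf b ^ 2 = eulerf b * (2 * eulerf (2 * b) ^ 2)"
    by (rule LIMSEQ_unique)
  hence "eulerf b * (double_psi b * eulerf b) = eulerf b * (2 * eulerf (2 * b) ^ 2)"
    by (simp add: power2_eq_square mult_ac)
  moreover have "eulerf b \<noteq> 0" using assms by (rule eulerf_nonzero)
  ultimately show ?thesis by simp
qed

text \<open>
  Gauss's identity for squares. The Gaussian binomial coefficients are taken in base \<open>q\<^bsup>2b\<^esup>\<close>, and
  the finite products run over odd exponents only; multiplying by the factors with even exponents
  completes them to \<open>partial_euler b (2 * n)\<close>.
\<close>

lemma phi_mult:
  assumes "b > 0"
  shows "phi b * eulerf (2 * b) = eulerf b ^ 2"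
proof -
  define c where "c = (\<Sum>j\<le>0. fps_const (alt_sign (- int j))
      * fps_X ^ (b * nat ((- int j) ^ 2)) * gauss_binomial (fps_X ^ (2 * b)) 0 j :: int fps)"
  define Q :: "nat \<Rightarrow> int fps" where "Q = (\<lambda>n. \<Prod>i<n. 1 + fps_const (- 1) * fps_X ^ (b * Suc (2 * i)))"
  have c: "c = 1"
    unfolding c_def by (simp add: alt_sign_def)
  have "(\<lambda>n. eulerf (2 * b) * (c * Q n ^ 2)) \<longlonglongrightarrow> phi b"
    unfolding c_def phi_def Q_def
  proof (rule theta_product_tendsto)
    show "\<bar>k\<bar> \<le> int (b * nat (k ^ 2)) + 1" for k
      by (rule le_mult_growth[OF assms abs_le_square])
    show "alt_sign (k - 1) + alt_sign (k + 1) = 2 * - 1 * alt_sign k" for k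
      by (simp add: alt_sign_shift)
  qed (use assms square_exponents[of _ _ b] in auto)
  hence "(\<lambda>n. eulerf (2 * b) * (c * Q n ^ 2) * partial_euler (2 * b) n ^ 2)
           \<longlonglongrightarrow> phi b * eulerf (2 * b) ^ 2"
    using assms by (intro tendsto_fps_mult tendsto_fps_power partial_euler_tendsto) auto
  moreover have "Q n * partial_euler (2 * b) n = partial_euler b (2 * n)" for n
  proof (induction n)
    case (Suc n)
    have e: "fps_X ^ (b * Suc (2 * n)) = ((fps_X ^ b) ^ Suc (2 * n) :: int fps)"
      "fps_X ^ (2 * b * Suc n) = ((fps_X ^ b) ^ Suc (Suc (2 * n)) :: int fps)"
      by (simp_all add: power_mult[symmetric] algebra_simps del: power_Suc)
    have Q_Suc: "Q (Suc n) = Q n * (1 - fps_X ^ (b * Suc (2 * n)))"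
      by (simp add: Q_def del: power_Suc mult_Suc_right flip: fps_const_neg)
    have pe_Suc: "partial_euler (2 * b) (Suc n) = partial_euler (2 * b) n * (1 - fps_X ^ (2 * b * Suc n))"
      by (simp add: partial_euler_def del: power_Suc mult_Suc_right flip: power_mult)
    have "Q (Suc n) * partial_euler (2 * b) (Suc n)
        = (Q n * partial_euler (2 * b) n) * ((1 - fps_X ^ (b * Suc (2 * n))) * (1 - fps_X ^ (2 * b * Suc n)))"
      unfolding Q_Suc pe_Suc by (simp only: mult_ac)
    also have "\<dots> = partial_euler b (2 * Suc n)"
      unfolding Suc.IH e by (simp add: partial_euler_def mult.assoc del: power_Suc)
    finally show ?case .
  qed (simp_all add: Q_def partial_euler_def)
  hence "eulerf (2 * b) * (c * Q n ^ 2) * partial_euler (2 * b) n ^ 2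
           = eulerf (2 * b) * partial_euler b (2 * n) ^ 2" for n
    by (simp add: c mult.assoc flip: power_mult_distrib)
  ultimately have "(\<lambda>n. eulerf (2 * b) * partial_euler b (2 * n) ^ 2) \<longlonglongrightarrow> phi b * eulerf (2 * b) ^ 2"
    by simp
  moreover have "(\<lambda>n. partial_euler b (2 * n)) \<longlonglongrightarrow> eulerf b"
    using LIMSEQ_subseq_LIMSEQ[OF partial_euler_tendsto[OF assms], of "\<lambda>n. 2 * n"]
    by (simp add: strict_mono_def o_def)
  hence "(\<lambda>n. eulerf (2 * b) * partial_euler b (2 * n) ^ 2) \<longlonglongrightarrow> eulerf (2 * b) * eulerf b ^ 2"
    by (intro tendsto_fps_mult tendsto_fps_power tendsto_const)
  ultimately have "phi b * eulerf (2 * b) ^ 2 = eulerf (2 * b) * eulerf b ^ 2"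
    by (rule LIMSEQ_unique)
  hence "eulerf (2 * b) * (phi b * eulerf (2 * b)) = eulerf (2 * b) * eulerf b ^ 2"
    by (simp add: power2_eq_square mult_ac)
  moreover have "eulerf (2 * b) \<noteq> 0" using assms by (intro eulerf_nonzero) simp
  ultimately show ?thesis by simp
qed

section \<open>Sections modulo 5\<close>

text \<open>
  The coefficients in the residue class \<open>r\<close> modulo 5. If this class is hit only by the indices
  \<open>k \<equiv> s\<close>, and the substitution \<open>k \<mapsto> 5k + s\<close> reproduces exponents and coefficients up to
  scaling, then the section is again a theta series. The scaling factor 25 of the exponents becomes
  5, since passing to the section divides exponents by 5.
\<close>

lemma theta_nth_section:
  assumes res: "\<And>k. e k mod 5 = r \<Longrightarrow> k mod 5 = s" and "r < 5" and "0 \<le> s" "s < 5"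
    and e: "\<And>k. e (5 * k + s) = 25 * e k + 5 * t + r"
    and a: "\<And>k. a (5 * k + s) = c * a k"
  shows "theta a e $ (5 * n + r) = (fps_const c * (fps_X ^ t * theta a (\<lambda>k. 5 * e k))) $ n"
proof -
  have "theta a e $ (5 * n + r) = (\<Sum>k | e k = 5 * n + r. a k)"
    by (simp add: theta_def)
  also have "\<dots> = (\<Sum>k | 5 * e k + t = n. c * a k)"
  proof (rule sum.reindex_bij_witness[of _ "\<lambda>k. 5 * k + s" "\<lambda>k. k div 5"])
    fix k assume "k \<in> {k. e k = 5 * n + r}"
    hence k: "e k = 5 * n + r" by simp
    hence "e k mod 5 = r" using \<open>r < 5\<close> by simp
    hence "k mod 5 = s" by (rule res)
    thus *: "5 * (k div 5) + s = k" by (metis mult_div_mod_eq)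
    show "k div 5 \<in> {k. 5 * e k + t = n}"
      using e[of "k div 5"] k unfolding * by simp
    show "c * a (k div 5) = a k"
      using a[of "k div 5"] unfolding * by simp
  qed (use assms in auto)
  also have "\<dots> = c * (if t \<le> n then (\<Sum>k | 5 * e k = n - t. a k) else 0)"
  proof (cases "t \<le> n")
    case True
    hence "{k. 5 * e k + t = n} = {k. 5 * e k = n - t}" by auto
    thus ?thesis using True by (simp add: sum_distrib_left)
  next
    case False
    hence "{k. 5 * e k + t = n} = {}" by auto
    thus ?thesis using False by simp
  qed
  also have "\<dots> = (fps_const c * (fps_X ^ t * theta a (\<lambda>k. 5 * e k))) $ n"
    by (auto simp: theta_def fps_X_power_mult_nth)
  finally show ?thesis .
qed

lemma theta_nth_nonzeroE:
  assumes "theta a e $ i \<noteq> 0"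
  obtains k where "e k = i"
proof (cases "{k. e k = i} = {}")
  case True
  thus ?thesis using assms by (simp add: theta_def)
qed (use that in auto)

text \<open>
  A residue class of a product is in general a sum over all pairs of classes of the factors. It is
  the product of two single sections as soon as no other pair of occupied classes has the same sum;
  this is where anisotropy of the quadratic forms enters.
\<close>

lemma nth_mult_section:
  fixes A B :: "'a::comm_ring_1 fps"
  assumes A: "\<And>n. A $ (5 * n + r) = C $ n" and B: "\<And>n. B $ (5 * n + s) = D $ n"
    and "\<And>i j. A $ i \<noteq> 0 \<Longrightarrow> B $ j \<noteq> 0 \<Longrightarrow> (i + j) mod 5 = (r + s) mod 5 \<Longrightarrow> i mod 5 = r \<and> j mod 5 = s"
  shows "(A * B) $ (5 * n + (r + s)) = (C * D) $ n"
proof -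
  have "(A * B) $ (5 * n + (r + s))
      = (\<Sum>i = 0..5 * n + (r + s). A $ i * B $ (5 * n + (r + s) - i))"
    by (simp add: fps_mult_nth)
  also have "\<dots> = (\<Sum>i \<in> (\<lambda>m. 5 * m + r) ` {0..n}. A $ i * B $ (5 * n + (r + s) - i))"
  proof (intro sum.mono_neutral_right ballI)
    fix i assume i: "i \<in> {0..5 * n + (r + s)} - (\<lambda>m. 5 * m + r) ` {0..n}"
    define j where "j = 5 * n + (r + s) - i"
    show "A $ i * B $ (5 * n + (r + s) - i) = 0"
    proof (rule ccontr)
      assume "A $ i * B $ (5 * n + (r + s) - i) \<noteq> 0"
      hence "A $ i \<noteq> 0" "B $ j \<noteq> 0" by (auto simp: j_def)
      moreover have ij: "i + j = 5 * n + (r + s)" using i by (simp add: j_def)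
      hence "(i + j) mod 5 = (r + s) mod 5" by simp
      ultimately have "i mod 5 = r" "j mod 5 = s" using assms(3) by blast+
      hence "i = 5 * (i div 5) + r" "j = 5 * (j div 5) + s" by (metis mult_div_mod_eq)+
      moreover from this ij have "i div 5 \<le> n" by linarith
      ultimately show False using i by auto
    qed
  qed auto
  also have "\<dots> = (\<Sum>m = 0..n. A $ (5 * m + r) * B $ (5 * (n - m) + s))"
  proof (subst sum.reindex)
    have "5 * n + (r + s) - (5 * m + r) = 5 * (n - m) + s" if "m \<le> n" for m
      using that by simp
    thus "sum ((\<lambda>i. A $ i * B $ (5 * n + (r + s) - i)) \<circ> (\<lambda>m. 5 * m + r)) {0..n}
        = (\<Sum>m = 0..n. A $ (5 * m + r) * B $ (5 * (n - m) + s))"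
      by (intro sum.cong) (auto simp del: diff_diff_left)
  qed (auto simp: inj_on_def)
  also have "\<dots> = (C * D) $ n"
    by (simp add: A B fps_mult_nth)
  finally show ?thesis .
qed

lemma theta_scale_nth: "theta a (\<lambda>k. 5 * e k) $ (5 * n) = theta a e $ n"
  by (simp add: theta_def)

lemma nth_mult_theta_scale:
  assumes "\<And>n. A $ (5 * n + r) = C $ n" and "r < 5"
  shows "(A * theta a (\<lambda>k. 5 * e k)) $ (5 * n + r) = (C * theta a e) $ n"
proof -
  have "(A * theta a (\<lambda>k. 5 * e k)) $ (5 * n + (r + 0)) = (C * theta a e) $ n"
  proof (rule nth_mult_section)
    fix i j assume "theta a (\<lambda>k. 5 * e k) $ j \<noteq> 0" "(i + j) mod 5 = (r + 0) mod 5"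
    moreover from this(1) obtain k where "j = 5 * e k" by (auto elim: theta_nth_nonzeroE)
    ultimately show "i mod 5 = r \<and> j mod 5 = 0" using assms(2) by simp
  qed (use assms theta_scale_nth in auto)
  thus ?thesis by simp
qed

lemma mod5_cases:
  obtains q where "k = 5 * q" | q where "k = 5 * q + 1" | q where "k = 5 * q + 2"
    | q where "k = 5 * q + 3" | q where "k = 5 * q + (4::int)"
proof -
  have "k mod 5 \<in> {0,1,2,3,4}" by auto
  thus ?thesis using that by (metis add.right_neutral insert_iff empty_iff mult_div_mod_eq)
qed

lemma triangular_mod5: "triangular k mod 5 \<in> {0, 1, 3}"
  and triangular_mod5_eq_3: "triangular k mod 5 = 3 \<Longrightarrow> k mod 5 = 2"
proof -
  define t where "t = triangular k"
  have T: "2 * int t = k * (k + 1)" by (simp add: t_def two_triangular)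
  have "t mod 5 \<in> {0, 1, 3} \<and> (t mod 5 = 3 \<longrightarrow> k mod 5 = 2)"
  proof (rule mod5_cases[of k])
    fix q assume k: "k = 5 * q"
    obtain z where "2 * int t = 5 * z + 0"
      using T[unfolded k] that[of "q * (5 * q + 1)"] by (simp add: algebra_simps)
    thus ?thesis using k unfolding insert_iff empty_iff by presburger
  next
    fix q assume k: "k = 5 * q + 1"
    obtain z where "2 * int t = 5 * z + 2"
      using T[unfolded k] that[of "q * (5 * q + 3)"] by (simp add: algebra_simps)
    thus ?thesis using k unfolding insert_iff empty_iff by presburger
  next
    fix q assume k: "k = 5 * q + 2"
    obtain z where "2 * int t = 5 * z + 6"
      using T[unfolded k] that[of "q * (5 * q + 5)"] by (simp add: algebra_simps)
    thus ?thesis using k unfolding insert_iff empty_iff by presburger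
  next
    fix q assume k: "k = 5 * q + 3"
    obtain z where "2 * int t = 5 * z + 12"
      using T[unfolded k] that[of "q * (5 * q + 7)"] by (simp add: algebra_simps)
    thus ?thesis using k unfolding insert_iff empty_iff by presburger
  next
    fix q assume k: "k = 5 * q + 4"
    obtain z where "2 * int t = 5 * z + 20"
      using T[unfolded k] that[of "q * (5 * q + 9)"] by (simp add: algebra_simps)
    thus ?thesis using k unfolding insert_iff empty_iff by presburger
  qed
  thus "triangular k mod 5 \<in> {0, 1, 3}" "triangular k mod 5 = 3 \<Longrightarrow> k mod 5 = 2"
    unfolding t_def by blast+
qed

lemma square_mod5: "nat (k ^ 2) mod 5 \<in> {0, 1, 4}"
  and square_mod5_eq_0: "nat (k ^ 2) mod 5 = 0 \<Longrightarrow> k mod 5 = 0"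
proof -
  define t where "t = nat (k ^ 2)"
  have T: "int t = k * k" by (simp add: t_def power2_eq_square)
  have "t mod 5 \<in> {0, 1, 4} \<and> (t mod 5 = 0 \<longrightarrow> k mod 5 = 0)"
  proof (rule mod5_cases[of k])
    fix q assume k: "k = 5 * q"
    obtain z where "int t = 5 * z + 0"
      using T[unfolded k] that[of "5 * q * q"] by (simp add: algebra_simps)
    thus ?thesis using k unfolding insert_iff empty_iff by presburger
  next
    fix q assume k: "k = 5 * q + 1"
    obtain z where "int t = 5 * z + 1"
      using T[unfolded k] that[of "q * (5 * q + 2)"] by (simp add: algebra_simps)
    thus ?thesis using k unfolding insert_iff empty_iff by presburger
  next
    fix q assume k: "k = 5 * q + 2"
    obtain z where "int t = 5 * z + 4"
      using T[unfolded k] that[of "q * (5 * q + 4)"] by (simp add: algebra_simps)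
    thus ?thesis using k unfolding insert_iff empty_iff by presburger
  next
    fix q assume k: "k = 5 * q + 3"
    obtain z where "int t = 5 * z + 9"
      using T[unfolded k] that[of "q * (5 * q + 6)"] by (simp add: algebra_simps)
    thus ?thesis using k unfolding insert_iff empty_iff by presburger
  next
    fix q assume k: "k = 5 * q + 4"
    obtain z where "int t = 5 * z + 16"
      using T[unfolded k] that[of "q * (5 * q + 8)"] by (simp add: algebra_simps)
    thus ?thesis using k unfolding insert_iff empty_iff by presburger
  qed
  thus "nat (k ^ 2) mod 5 \<in> {0, 1, 4}" "nat (k ^ 2) mod 5 = 0 \<Longrightarrow> k mod 5 = 0"
    unfolding t_def by simp_all
qed

lemma triangular_section: "triangular (5 * k + 2) = 25 * triangular k + 3"
proof -
  have "int (triangular (5 * k + 2)) = int (25 * triangular k + 3)"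
    using two_triangular[of "5 * k + 2"] two_triangular[of k] by (simp add: algebra_simps)
  thus ?thesis by (simp only: of_nat_eq_iff)
qed

lemma alt_sign_section: "alt_sign (5 * k + 2) = alt_sign k" "alt_sign (5 * k) = alt_sign k"
  by (simp_all add: alt_sign_def)

lemma cube_coeff_section: "alt_sign (5 * k + 2) * (2 * (5 * k + 2) + 1) = 5 * (alt_sign k * (2 * k + 1))"
  unfolding alt_sign_section by (simp add: algebra_simps)

lemma double_psi_1_section: "double_psi 1 $ (5 * n + 3) = double_psi 5 $ n"
  using theta_nth_section[of triangular 3 2 0 "\<lambda>_. 1" 1 n] triangular_mod5_eq_3 triangular_section
  by (simp add: double_psi_def)

lemma double_cube_1_section: "double_cube 1 $ (5 * n + 3) = (5 * double_cube 5) $ n"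
  using theta_nth_section[of triangular 3 2 0 "\<lambda>k. alt_sign k * (2 * k + 1)" 5 n]
    triangular_mod5_eq_3 triangular_section cube_coeff_section
  by (simp add: double_cube_def numeral_fps_const)

lemma double_cube_2_section: "double_cube 2 $ (5 * n + 1) = (5 * (fps_X * double_cube 10)) $ n"
proof -
  have "k mod 5 = 2" if "(2 * triangular k) mod 5 = 1" for k
    by (rule triangular_mod5_eq_3) (use that in presburger)
  thus ?thesis
    using theta_nth_section[of "\<lambda>k. 2 * triangular k" 1 2 1 "\<lambda>k. alt_sign k * (2 * k + 1)" 5 n]
      triangular_section cube_coeff_section
    by (simp add: double_cube_def numeral_fps_const)
qed

lemma phi_1_section: "phi 1 $ (5 * n) = phi 5 $ n"
proof -
  have "nat ((5 * k) ^ 2) = 25 * nat (k ^ 2)" for k :: int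
    by (simp add: power_mult_distrib nat_mult_distrib)
  thus ?thesis
    using theta_nth_section[of "\<lambda>k. nat (k ^ 2)" 0 0 0 alt_sign 1 n] square_mod5_eq_0
    by (simp add: phi_def alt_sign_section)
qed

text \<open>
  The occupied classes are \<open>{0, 1, 3}\<close> and \<open>{0, 1, 2}\<close>, and \<open>3 + 1\<close> is the only way to
  reach 4 modulo 5.
\<close>

lemma double_psi_double_cube_section:
  "(double_psi 1 * double_cube 2) $ (5 * n + 4) = (double_psi 5 * (5 * (fps_X * double_cube 10))) $ n"
proof -
  have "(double_psi 1 * double_cube 2) $ (5 * n + (3 + 1)) = (double_psi 5 * (5 * (fps_X * double_cube 10))) $ n"
  proof (rule nth_mult_section[OF double_psi_1_section double_cube_2_section])
    fix i j assume "double_psi 1 $ i \<noteq> 0" "double_cube 2 $ j \<noteq> 0" and ij: "(i + j) mod 5 = (3 + 1) mod 5"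
    then obtain k l where kl: "i = triangular k" "j = 2 * triangular l"
      unfolding double_psi_def double_cube_def by (auto elim!: theta_nth_nonzeroE)
    have "j mod 5 = 2 * (triangular l mod 5) mod 5"
      unfolding kl by (simp only: mod_mult_right_eq)
    hence "i mod 5 \<in> {0, 1, 3}" "j mod 5 \<in> {0, 1, 2}"
      using triangular_mod5[of k] triangular_mod5[of l] kl(1) by auto
    moreover have "(i mod 5 + j mod 5) mod 5 = 4"
      using ij by (simp add: mod_add_eq)
    ultimately show "i mod 5 = 3 \<and> j mod 5 = 1" by auto
  qed
  thus ?thesis by simp
qed

text \<open>
  The occupied classes are \<open>{0, 1, 4}\<close> and \<open>{0, 1, 3}\<close>, and \<open>0 + 3\<close> is the only way to
  reach 3 modulo 5.
\<close>

lemma phi_double_cube_section: "(phi 1 * double_cube 1) $ (5 * n + 3) = (phi 5 * (5 * double_cube 5)) $ n"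
proof -
  have "(phi 1 * double_cube 1) $ (5 * n + (0 + 3)) = (phi 5 * (5 * double_cube 5)) $ n"
  proof (rule nth_mult_section[OF _ double_cube_1_section])
    fix i j assume "phi 1 $ i \<noteq> 0" "double_cube 1 $ j \<noteq> 0" and ij: "(i + j) mod 5 = (0 + 3) mod 5"
    then obtain k l where "i = nat (k ^ 2)" "j = triangular l"
      unfolding phi_def double_cube_def by (auto elim!: theta_nth_nonzeroE)
    hence "i mod 5 \<in> {0, 1, 4}" "j mod 5 \<in> {0, 1, 3}"
      using square_mod5[of k] triangular_mod5[of l] by simp_all
    moreover have "(i mod 5 + j mod 5) mod 5 = 3"
      using ij by (simp add: mod_add_eq)
    ultimately show "i mod 5 = 0 \<and> j mod 5 = 3" by auto
  qed (use phi_1_section in simp)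
  thus ?thesis by simp
qed

lemma nth_mult_double_psi_5:
    "(\<And>n. A $ (5 * n + r) = C $ n) \<Longrightarrow> r < 5 \<Longrightarrow>
      (A * double_psi 5) $ (5 * n + r) = (C * double_psi 1) $ n"
  and nth_mult_double_cube_5:
    "(\<And>n. A $ (5 * n + r) = C $ n) \<Longrightarrow> r < 5 \<Longrightarrow>
      (A * double_cube 5) $ (5 * n + r) = (C * double_cube 1) $ n"
  and nth_mult_double_cube_10:
    "(\<And>n. A $ (5 * n + r) = C $ n) \<Longrightarrow> r < 5 \<Longrightarrow>
      (A * double_cube 10) $ (5 * n + r) = (C * double_cube 2) $ n"
  and nth_mult_phi_5:
    "(\<And>n. A $ (5 * n + r) = C $ n) \<Longrightarrow> r < 5 \<Longrightarrow>
      (A * phi 5) $ (5 * n + r) = (C * phi 1) $ n"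
  using nth_mult_theta_scale[of A r C "\<lambda>_. 1" triangular n]
    nth_mult_theta_scale[of A r C "\<lambda>k. alt_sign k * (2 * k + 1)" triangular n]
    nth_mult_theta_scale[of A r C "\<lambda>k. alt_sign k * (2 * k + 1)" "\<lambda>k. 2 * triangular k" n]
    nth_mult_theta_scale[of A r C alt_sign "\<lambda>k. nat (k ^ 2)" n]
  by (simp_all add: double_psi_def double_cube_def phi_def)

section \<open>The congruence\<close>

text \<open>
  The factor 8 stems from the three doubled series on the right.
\<close>

lemma M_theta: "8 * Abs_fps M = double_psi 1 * double_cube 2 * phi 5 * double_cube 5"
proof -
  have nz: "eulerf 1 * eulerf 10 \<noteq> 0"
    by (simp add: eulerf_nonzero)
  have "8 * Abs_fps M * (eulerf 1 * eulerf 10) = 8 * (eulerf 2 ^ 5 * eulerf 5 ^ 5)"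
    unfolding M_mult_denominator[symmetric] by (simp only: mult_ac)
  also have "\<dots> = (2 * eulerf 2 ^ 2) * (2 * eulerf 2 ^ 3) * eulerf 5 ^ 2 * (2 * eulerf 5 ^ 3)"
    by (simp add: eval_nat_numeral algebra_simps)
  also have "\<dots> = (double_psi 1 * eulerf 1) * double_cube 2 * (phi 5 * eulerf 10) * double_cube 5"
    using double_psi_mult[of 1] phi_mult[of 5] double_cube_eq[of 2] double_cube_eq[of 5] by simp
  also have "\<dots> = (double_psi 1 * double_cube 2 * phi 5 * double_cube 5) * (eulerf 1 * eulerf 10)"
    by (simp only: mult_ac)
  finally show ?thesis using nz by simp
qed

text \<open>
  Because of the three doubled series, this is \<open>8 \<phi>(-q) f\<^sub>1\<^sup>3 \<psi>(q\<^sup>5) f\<^bsub>10\<^esub>\<^sup>3\<close>.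
\<close>

definition companion :: "int fps" where
  "companion = phi 1 * double_cube 1 * double_psi 5 * double_cube 10"

text \<open>
  The factors \<open>\<phi>(-q\<^sup>5)\<close> and \<open>f\<^sub>5\<^sup>3\<close> are series in \<open>q\<^sup>5\<close> and pass through the section, turning into
  \<open>\<phi>(-q)\<close> and \<open>f\<^sub>1\<^sup>3\<close>.
\<close>

lemma M_section: "8 * M (5 * n + 4) = 5 * (fps_X * companion) $ n"
proof -
  have "8 * M (5 * n + 4) = (double_psi 1 * double_cube 2 * phi 5 * double_cube 5) $ (5 * n + 4)"
    unfolding M_theta[symmetric] by (simp add: numeral_fps_const)
  also have "\<dots> = (double_psi 5 * (5 * (fps_X * double_cube 10)) * phi 1 * double_cube 1) $ n"
    by (intro nth_mult_double_cube_5 nth_mult_phi_5 double_psi_double_cube_section) auto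
  also have "double_psi 5 * (5 * (fps_X * double_cube 10)) * phi 1 * double_cube 1 = 5 * (fps_X * companion)"
    unfolding companion_def by (simp only: mult_ac)
  finally show ?thesis by (simp add: numeral_fps_const)
qed

lemma companion_section: "companion $ (5 * n + 3) = 40 * M n"
proof -
  have "companion $ (5 * n + 3) = (phi 5 * (5 * double_cube 5) * double_psi 1 * double_cube 2) $ n"
    unfolding companion_def by (intro nth_mult_double_cube_10 nth_mult_double_psi_5 phi_double_cube_section) auto
  also have "phi 5 * (5 * double_cube 5) * double_psi 1 * double_cube 2 = 5 * (8 * Abs_fps M)"
    unfolding M_theta by (simp only: mult_ac)
  finally show ?thesis by (simp add: numeral_fps_const)
qed

lemma M_dvd_5: "5 dvd M (5 * n + 4)"
proof -
  have "5 dvd 8 * M (5 * n + 4)" unfolding M_section by simp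
  thus ?thesis by presburger
qed

lemma M_25_mult: "M (25 * n + 24) = 25 * M n"
proof -
  have "8 * M (5 * (5 * n + 4) + 4) = 5 * (fps_X * companion) $ (5 * n + 4)"
    by (rule M_section)
  also have "(fps_X * companion) $ (5 * n + 4) = companion $ (5 * n + 3)" by (simp add: add.commute)
  also have "\<dots> = 40 * M n" by (rule companion_section)
  finally show ?thesis by (simp add: algebra_simps)
qed

theorem corollary2:
  fixes n \<alpha> :: nat
  assumes "\<alpha> \<ge> 1"
  shows "[M (5 ^ \<alpha> * n + 5 ^ \<alpha> - 1) = 0] (mod 5 ^ \<alpha>)"
proof -
  have "5 ^ \<alpha> dvd M (5 ^ \<alpha> * n + 5 ^ \<alpha> - 1)"
    \<comment> \<open>A step from \<open>\<alpha>\<close> to \<open>\<alpha> + 2\<close> needs the trivial case \<open>\<alpha> = 0\<close> as its second base.\<close>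
  proof (induction \<alpha> rule: induct_nat_012)
    case 1
    show ?case using M_dvd_5[of n] by (simp add: add.commute)
  next
    case (ge2 \<alpha>)
    define x :: nat where "x = 5 ^ \<alpha> * n + 5 ^ \<alpha>"
    have "x \<ge> 1" by (simp add: x_def Suc_le_eq)
    hence "25 * x - 1 = 25 * (x - 1) + 24" by simp
    moreover have "5 ^ Suc (Suc \<alpha>) * n + 5 ^ Suc (Suc \<alpha>) = 25 * x"
      by (simp add: x_def algebra_simps)
    ultimately have "5 ^ Suc (Suc \<alpha>) * n + 5 ^ Suc (Suc \<alpha>) - 1
        = 25 * (5 ^ \<alpha> * n + 5 ^ \<alpha> - 1) + 24"
      by (simp only: x_def)
    hence "M (5 ^ Suc (Suc \<alpha>) * n + 5 ^ Suc (Suc \<alpha>) - 1) = 25 * M (5 ^ \<alpha> * n + 5 ^ \<alpha> - 1)"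
      by (simp only: M_25_mult)
    thus ?case using ge2.IH(1) by simp
  qed simp
  thus ?thesis by (simp add: cong_0_iff)
qed

end
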